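(* For a semigroup $X$ the following conditions are equivalent: (1) the semigroup $\varphi(X)$ is linear; (2) the semigroup $N_2(X)$ is linear; (3) either $X$ is a semigroup of left zeros, or $X$ is a semigroup of right zeros, or else $X$ is a semilattice of order $|X|\le 2$.
   Context: A semigroup $S$ is linear if $xy\in\{x,y\}$ for all $x,y\in S$. A semigroup $S$ is a semigroup of left (resp. right) zeros if $xy=x$ (resp. $xy=y$) for all $x,y\in S$. A semilattice is a commutative semigroup with $xx=x$ for all $x$. For a set $X$, an upfamily on $X$ is a non-empty family $\mathcal F$ of non-empty subsets of $X$ such that $A\in\mathcal F$ and $A\subset B\subset X$ imply $B\in\mathcal F$. For a family $\mathcal B$ of subsets of $X$, $\langle\mathcal B\rangle=\{A\subset X:\exists B\in\mathcal B,\ B\subset A\}$. An upfamily $\mathcal A$ is a filter if $A_1\cap A_2\in\mathcal A$ for all $A_1,A_2\in\mathcal A$; linked if $A\cap B\neq\emptyset$ for all $A,B\in\mathcal A$. $\varphi(X)$ and $N_2(X)$ are the sets of all filters and of all linked upfamilies on $X$, respectively. If $X$ is a semigroup, both are semigroups under the operation $\mathcal U*\mathcal V=\big\langle\bigcup_{x\in U}xV_x: U\in\mathcal U,\ (V_x)_{x\in U}\in\mathcal V^U\big\rangle$. *)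

theory Defs
  imports "HOL-Library.FuncSet"
begin

text \<open>
  Semigroups are given by an explicit carrier, so that the same notions apply to the ground
  semigroup and to the semigroups of upfamilies over it. The carrier may be empty.
\<close>

locale semigroup_on =
  fixes S :: "'a set" and mult :: "'a \<Rightarrow> 'a \<Rightarrow> 'a"
  assumes closed: "x \<in> S \<Longrightarrow> y \<in> S \<Longrightarrow> mult x y \<in> S"
    and assoc: "x \<in> S \<Longrightarrow> y \<in> S \<Longrightarrow> z \<in> S \<Longrightarrow> mult (mult x y) z = mult x (mult y z)"

definition linear_semigroup :: "'a set \<Rightarrow> ('a \<Rightarrow> 'a \<Rightarrow> 'a) \<Rightarrow> bool" where
  "linear_semigroup S mult \<longleftrightarrow>
     semigroup_on S mult \<and> (\<forall>x\<in>S. \<forall>y\<in>S. mult x y \<in> {x, y})"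

definition left_zeros :: "'a set \<Rightarrow> ('a \<Rightarrow> 'a \<Rightarrow> 'a) \<Rightarrow> bool" where
  "left_zeros S mult \<longleftrightarrow> semigroup_on S mult \<and> (\<forall>x\<in>S. \<forall>y\<in>S. mult x y = x)"

definition right_zeros :: "'a set \<Rightarrow> ('a \<Rightarrow> 'a \<Rightarrow> 'a) \<Rightarrow> bool" where
  "right_zeros S mult \<longleftrightarrow> semigroup_on S mult \<and> (\<forall>x\<in>S. \<forall>y\<in>S. mult x y = y)"

definition semilattice_on :: "'a set \<Rightarrow> ('a \<Rightarrow> 'a \<Rightarrow> 'a) \<Rightarrow> bool" where
  "semilattice_on S mult \<longleftrightarrow>
     semigroup_on S mult \<and> (\<forall>x\<in>S. \<forall>y\<in>S. mult x y = mult y x) \<and> (\<forall>x\<in>S. mult x x = x)"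

definition upfamily :: "'a set \<Rightarrow> 'a set set \<Rightarrow> bool" where
  "upfamily X \<F> \<longleftrightarrow>
     \<F> \<noteq> {} \<and> (\<forall>A\<in>\<F>. A \<subseteq> X \<and> A \<noteq> {}) \<and>
     (\<forall>A B. A \<in> \<F> \<and> A \<subseteq> B \<and> B \<subseteq> X \<longrightarrow> B \<in> \<F>)"

definition generated :: "'a set \<Rightarrow> 'a set set \<Rightarrow> 'a set set" where
  "generated X \<B> = {A. A \<subseteq> X \<and> (\<exists>B\<in>\<B>. B \<subseteq> A)}"

definition filters :: "'a set \<Rightarrow> 'a set set set" where
  "filters X = {\<A>. upfamily X \<A> \<and> (\<forall>A\<^sub>1\<in>\<A>. \<forall>A\<^sub>2\<in>\<A>. A\<^sub>1 \<inter> A\<^sub>2 \<in> \<A>)}"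

definition linked_upfamilies :: "'a set \<Rightarrow> 'a set set set" where
  "linked_upfamilies X = {\<A>. upfamily X \<A> \<and> (\<forall>A\<in>\<A>. \<forall>B\<in>\<A>. A \<inter> B \<noteq> {})}"

definition upfamily_mult ::
  "'a set \<Rightarrow> ('a \<Rightarrow> 'a \<Rightarrow> 'a) \<Rightarrow> 'a set set \<Rightarrow> 'a set set \<Rightarrow> 'a set set" where
  "upfamily_mult X mult \<U> \<V> =
     generated X {(\<Union>x\<in>U. mult x ` V x) | U V. U \<in> \<U> \<and> V \<in> U \<rightarrow> \<V>}"

end

theory Submission
  imports Defs
begin

text \<open>
  Two observations reduce the theorem to elementary combinatorics of subsets of \<open>X\<close>.

  First, membership in a product of upfamilies can be tested without choosing a family of sets:
  \<open>A \<in> \<U> * \<V>\<close> says that \<open>{x. {y. xy \<in> A} \<in> \<V>} \<in> \<U>\<close> (lemma \<open>mem_upfamily_mult\<close>). In this form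
  associativity is a rewriting of nested set comprehensions, and filters and linked upfamilies are
  visibly closed under the product. So both are always semigroups, and linearity only concerns
  the values \<open>\<U> * \<V>\<close>.

  Second, the principal filter of a nonempty set \<open>A\<close> times the principal filter of \<open>B\<close> is the
  principal filter of the complex product \<open>AB\<close> (lemma \<open>principal_mult_principal\<close>). So, if the
  filters are linear, then \<open>AB \<in> {A, B}\<close> for all nonempty \<open>A\<close> and \<open>B\<close>. Taking singletons, \<open>X\<close> is
  itself linear, hence idempotent. If \<open>ab \<noteq> ba\<close>, then \<open>a, b\<close> is a pair of left zeros or of right
  zeros; testing sets with at most two elements against singletons spreads this to all of \<open>X\<close>
  (lemma \<open>left_zero_pair_spreads\<close>). If \<open>X\<close> is commutative it is a chain, and three
  elements \<open>a < b < c\<close> of it would give \<open>{a, c}{b} = {a, b}\<close>, which is neither factor.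

  Conversely, over left or right zeros the product of upfamilies is the first or the second factor.
  On a set with at most two elements every linked upfamily is principal, and every nonempty
  subset is a singleton or the whole set, so that linearity is again a statement about
  complex products. Finally, filters are linked, so linearity passes from linked upfamilies to
  filters.
\<close>

section \<open>The semigroup of upfamilies\<close>

lemma upfamily_up:
  "upfamily X \<F> \<Longrightarrow> A \<in> \<F> \<Longrightarrow> A \<subseteq> B \<Longrightarrow> B \<subseteq> X \<Longrightarrow> B \<in> \<F>"
  unfolding upfamily_def by blast

lemma upfamily_carrier_mem: "upfamily X \<F> \<Longrightarrow> X \<in> \<F>"
  unfolding upfamily_def by blast

text \<open>
  The sets \<open>V\<^sub>x\<close> in the definition of the product may be replaced by the largest candidates
  \<open>{y \<in> X. xy \<in> A}\<close>, and then \<open>U\<close> by the set of all \<open>x\<close> for which this candidate lies in \<open>\<V>\<close>.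
\<close>

lemma mem_upfamily_mult:
  assumes U: "upfamily X \<U>" and V: "upfamily X \<V>"
  shows "A \<in> upfamily_mult X mult \<U> \<V> \<longleftrightarrow>
           A \<subseteq> X \<and> {x\<in>X. {y\<in>X. mult x y \<in> A} \<in> \<V>} \<in> \<U>"
    (is "?L \<longleftrightarrow> A \<subseteq> X \<and> ?S \<in> \<U>")
proof
  assume ?L
  then obtain W V where AX: "A \<subseteq> X" and W: "W \<in> \<U>" and Vf: "V \<in> W \<rightarrow> \<V>"
    and sub: "(\<Union>x\<in>W. mult x ` V x) \<subseteq> A"
    unfolding upfamily_mult_def generated_def by blast
  have "W \<subseteq> ?S"
  proof
    fix x assume x: "x \<in> W"
    have Vx: "V x \<in> \<V>" using x Vf by blast
    moreover have "V x \<subseteq> X" using V Vx unfolding upfamily_def by blast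
    ultimately have "V x \<subseteq> {y\<in>X. mult x y \<in> A}"
      using sub x by auto
    then have "{y\<in>X. mult x y \<in> A} \<in> \<V>"
      using upfamily_up[OF V Vx] by blast
    then show "x \<in> ?S" using x W U unfolding upfamily_def by blast
  qed
  then show "A \<subseteq> X \<and> ?S \<in> \<U>"
    using AX upfamily_up[OF U W] by blast
next
  assume R: "A \<subseteq> X \<and> ?S \<in> \<U>"
  let ?V = "\<lambda>x. {y\<in>X. mult x y \<in> A}"
  let ?P = "\<Union>x\<in>?S. mult x ` ?V x"
  have "?V \<in> ?S \<rightarrow> \<V>" by (rule Pi_I) simp
  then have "?P \<in> {(\<Union>x\<in>U. mult x ` V x) | U V. U \<in> \<U> \<and> V \<in> U \<rightarrow> \<V>}"
    using R by (intro CollectI exI[of _ ?S] exI[of _ ?V]) simp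
  moreover have "?P \<subseteq> A" by auto
  ultimately show ?L
    using R unfolding upfamily_mult_def generated_def by (intro CollectI conjI bexI[of _ ?P]) simp_all
qed

lemma upfamily_upfamily_mult:
  assumes "semigroup_on X mult" and U: "upfamily X \<U>" and V: "upfamily X \<V>"
  shows "upfamily X (upfamily_mult X mult \<U> \<V>)"
proof -
  interpret semigroup_on X mult by fact
  note mem = mem_upfamily_mult[OF U V, of _ mult]
  have "{y\<in>X. mult x y \<in> X} = X" if "x \<in> X" for x
    using closed[OF that] by blast
  then have "{x\<in>X. {y\<in>X. mult x y \<in> X} \<in> \<V>} = X"
    using upfamily_carrier_mem[OF V] by (simp cong: conj_cong)
  then have "X \<in> upfamily_mult X mult \<U> \<V>"
    using mem upfamily_carrier_mem[OF U] by simp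
  moreover have "A \<subseteq> X \<and> A \<noteq> {}" if "A \<in> upfamily_mult X mult \<U> \<V>" for A
  proof -
    have "A \<subseteq> X" and ne: "{x\<in>X. {y\<in>X. mult x y \<in> A} \<in> \<V>} \<noteq> {}"
      using mem[THEN iffD1, OF that] U unfolding upfamily_def by blast+
    moreover from ne obtain x where "{y\<in>X. mult x y \<in> A} \<in> \<V>" by blast
    then have "{y\<in>X. mult x y \<in> A} \<noteq> {}" using V unfolding upfamily_def by blast
    ultimately show ?thesis by blast
  qed
  moreover have "B \<in> upfamily_mult X mult \<U> \<V>"
    if A: "A \<in> upfamily_mult X mult \<U> \<V>" and AB: "A \<subseteq> B" and BX: "B \<subseteq> X" for A B
  proof -
    have "{x\<in>X. {y\<in>X. mult x y \<in> A} \<in> \<V>} \<subseteq> {x\<in>X. {y\<in>X. mult x y \<in> B} \<in> \<V>}"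
    proof (intro subsetI CollectI conjI)
      fix x assume x: "x \<in> {x\<in>X. {y\<in>X. mult x y \<in> A} \<in> \<V>}"
      then show "x \<in> X" by blast
      show "{y\<in>X. mult x y \<in> B} \<in> \<V>"
        by (rule upfamily_up[OF V, of "{y\<in>X. mult x y \<in> A}"]) (use x AB in auto)
    qed
    moreover have "{x\<in>X. {y\<in>X. mult x y \<in> A} \<in> \<V>} \<in> \<U>" using A mem by blast
    ultimately have "{x\<in>X. {y\<in>X. mult x y \<in> B} \<in> \<V>} \<in> \<U>"
      using upfamily_up[OF U] by blast
    then show ?thesis using mem BX by blast
  qed
  ultimately show ?thesis unfolding upfamily_def by blast
qed

lemma upfamily_mult_assoc:
  assumes sg: "semigroup_on X mult"
    and U: "upfamily X \<U>" and V: "upfamily X \<V>" and W: "upfamily X \<W>"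
  shows "upfamily_mult X mult (upfamily_mult X mult \<U> \<V>) \<W> =
         upfamily_mult X mult \<U> (upfamily_mult X mult \<V> \<W>)"
proof (rule set_eqI)
  fix A
  interpret semigroup_on X mult by (rule sg)
  note UV = upfamily_upfamily_mult[OF sg U V] and VW = upfamily_upfamily_mult[OF sg V W]
  let ?Z = "{z\<in>X. {w\<in>X. mult z w \<in> A} \<in> \<W>}"
  have "{y\<in>X. mult x y \<in> ?Z} = {y\<in>X. {w\<in>X. mult y w \<in> {u\<in>X. mult x u \<in> A}} \<in> \<W>}"
    if x: "x \<in> X" for x
  proof (rule Collect_cong, rule conj_cong[OF refl])
    fix y assume y: "y \<in> X"
    have "{w\<in>X. mult (mult x y) w \<in> A} = {w\<in>X. mult y w \<in> {u\<in>X. mult x u \<in> A}}"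
      using x y closed assoc by auto
    then show "mult x y \<in> ?Z \<longleftrightarrow> {w\<in>X. mult y w \<in> {u\<in>X. mult x u \<in> A}} \<in> \<W>"
      using x y closed by simp
  qed
  then have eq: "{x\<in>X. {y\<in>X. mult x y \<in> ?Z} \<in> \<V>} =
      {x\<in>X. {u\<in>X. mult x u \<in> A} \<in> upfamily_mult X mult \<V> \<W>}"
    unfolding mem_upfamily_mult[OF V W] by (intro Collect_cong conj_cong) auto
  have "A \<in> upfamily_mult X mult (upfamily_mult X mult \<U> \<V>) \<W> \<longleftrightarrow>
      A \<subseteq> X \<and> {x\<in>X. {y\<in>X. mult x y \<in> ?Z} \<in> \<V>} \<in> \<U>"
    unfolding mem_upfamily_mult[OF UV W] mem_upfamily_mult[OF U V] by auto
  also have "\<dots> \<longleftrightarrow> A \<in> upfamily_mult X mult \<U> (upfamily_mult X mult \<V> \<W>)"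
    unfolding eq mem_upfamily_mult[OF U VW] ..
  finally show "A \<in> upfamily_mult X mult (upfamily_mult X mult \<U> \<V>) \<W> \<longleftrightarrow>
      A \<in> upfamily_mult X mult \<U> (upfamily_mult X mult \<V> \<W>)" .
qed

lemma semigroup_on_filters:
  assumes sg: "semigroup_on X mult"
  shows "semigroup_on (filters X) (upfamily_mult X mult)"
proof
  fix \<U> \<V> assume "\<U> \<in> filters X" "\<V> \<in> filters X"
  then have U: "upfamily X \<U>" and V: "upfamily X \<V>"
    and UI: "\<And>A B. A \<in> \<U> \<Longrightarrow> B \<in> \<U> \<Longrightarrow> A \<inter> B \<in> \<U>"
    and VI: "\<And>A B. A \<in> \<V> \<Longrightarrow> B \<in> \<V> \<Longrightarrow> A \<inter> B \<in> \<V>"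
    unfolding filters_def by auto
  note mem = mem_upfamily_mult[OF U V, of _ mult]
  have "A \<inter> B \<in> upfamily_mult X mult \<U> \<V>"
    if A: "A \<in> upfamily_mult X mult \<U> \<V>" and B: "B \<in> upfamily_mult X mult \<U> \<V>" for A B
  proof -
    let ?S = "\<lambda>A. {x\<in>X. {y\<in>X. mult x y \<in> A} \<in> \<V>}"
    have "?S A \<inter> ?S B \<in> \<U>"
      using UI mem[THEN iffD1, OF A] mem[THEN iffD1, OF B] by blast
    moreover have "?S A \<inter> ?S B \<subseteq> ?S (A \<inter> B)"
    proof
      fix x assume x: "x \<in> ?S A \<inter> ?S B"
      then have "{y\<in>X. mult x y \<in> A} \<inter> {y\<in>X. mult x y \<in> B} \<in> \<V>" using VI by blast
      moreover have "{y\<in>X. mult x y \<in> A} \<inter> {y\<in>X. mult x y \<in> B} = {y\<in>X. mult x y \<in> A \<inter> B}"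
        by blast
      ultimately show "x \<in> ?S (A \<inter> B)" using x by simp
    qed
    ultimately have "?S (A \<inter> B) \<in> \<U>" using upfamily_up[OF U] by blast
    then show ?thesis using mem A by blast
  qed
  then show "upfamily_mult X mult \<U> \<V> \<in> filters X"
    using upfamily_upfamily_mult[OF sg U V] unfolding filters_def by blast
next
  fix \<U> \<V> \<W> assume "\<U> \<in> filters X" "\<V> \<in> filters X" "\<W> \<in> filters X"
  then show "upfamily_mult X mult (upfamily_mult X mult \<U> \<V>) \<W> =
      upfamily_mult X mult \<U> (upfamily_mult X mult \<V> \<W>)"
    unfolding filters_def by (intro upfamily_mult_assoc[OF sg]) simp_all
qed

lemma semigroup_on_linked_upfamilies:
  assumes sg: "semigroup_on X mult"
  shows "semigroup_on (linked_upfamilies X) (upfamily_mult X mult)"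
proof
  fix \<U> \<V> assume "\<U> \<in> linked_upfamilies X" "\<V> \<in> linked_upfamilies X"
  then have U: "upfamily X \<U>" and V: "upfamily X \<V>"
    and UL: "\<And>A B. A \<in> \<U> \<Longrightarrow> B \<in> \<U> \<Longrightarrow> A \<inter> B \<noteq> {}"
    and VL: "\<And>A B. A \<in> \<V> \<Longrightarrow> B \<in> \<V> \<Longrightarrow> A \<inter> B \<noteq> {}"
    unfolding linked_upfamilies_def by auto
  note mem = mem_upfamily_mult[OF U V, of _ mult]
  have "A \<inter> B \<noteq> {}"
    if A: "A \<in> upfamily_mult X mult \<U> \<V>" and B: "B \<in> upfamily_mult X mult \<U> \<V>" for A B
  proof -
    let ?S = "\<lambda>A. {x\<in>X. {y\<in>X. mult x y \<in> A} \<in> \<V>}"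
    have "?S A \<inter> ?S B \<noteq> {}"
      using UL mem[THEN iffD1, OF A] mem[THEN iffD1, OF B] by blast
    then obtain x where "{y\<in>X. mult x y \<in> A} \<in> \<V>" "{y\<in>X. mult x y \<in> B} \<in> \<V>" by blast
    then have "{y\<in>X. mult x y \<in> A} \<inter> {y\<in>X. mult x y \<in> B} \<noteq> {}" by (rule VL)
    then show ?thesis by blast
  qed
  then show "upfamily_mult X mult \<U> \<V> \<in> linked_upfamilies X"
    using upfamily_upfamily_mult[OF sg U V] unfolding linked_upfamilies_def by blast
next
  fix \<U> \<V> \<W>
  assume "\<U> \<in> linked_upfamilies X" "\<V> \<in> linked_upfamilies X" "\<W> \<in> linked_upfamilies X"
  then show "upfamily_mult X mult (upfamily_mult X mult \<U> \<V>) \<W> =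
      upfamily_mult X mult \<U> (upfamily_mult X mult \<V> \<W>)"
    unfolding linked_upfamilies_def by (intro upfamily_mult_assoc[OF sg]) simp_all
qed

lemma filters_subset_linked: "filters X \<subseteq> linked_upfamilies X"
proof
  fix \<F> assume "\<F> \<in> filters X"
  then have up: "upfamily X \<F>" and I: "\<And>A B. A \<in> \<F> \<Longrightarrow> B \<in> \<F> \<Longrightarrow> A \<inter> B \<in> \<F>"
    unfolding filters_def by auto
  have "{} \<notin> \<F>" using up unfolding upfamily_def by blast
  then have "A \<inter> B \<noteq> {}" if "A \<in> \<F>" "B \<in> \<F>" for A B
    using I[OF that] by metis
  then show "\<F> \<in> linked_upfamilies X" using up unfolding linked_upfamilies_def by blast
qed

section \<open>Principal filters and complex products\<close>

definition complex_product :: "('a \<Rightarrow> 'a \<Rightarrow> 'a) \<Rightarrow> 'a set \<Rightarrow> 'a set \<Rightarrow> 'a set" where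
  "complex_product mult A B = (\<Union>a\<in>A. mult a ` B)"

definition complex_linear :: "'a set \<Rightarrow> ('a \<Rightarrow> 'a \<Rightarrow> 'a) \<Rightarrow> bool" where
  "complex_linear X mult \<longleftrightarrow>
     (\<forall>A B. A \<subseteq> X \<and> A \<noteq> {} \<and> B \<subseteq> X \<and> B \<noteq> {} \<longrightarrow> complex_product mult A B \<in> {A, B})"

lemma complex_productI: "a \<in> A \<Longrightarrow> b \<in> B \<Longrightarrow> mult a b \<in> complex_product mult A B"
  unfolding complex_product_def by blast

lemma complex_product_subset_iff:
  "complex_product mult A B \<subseteq> C \<longleftrightarrow> (\<forall>a\<in>A. \<forall>b\<in>B. mult a b \<in> C)"
  unfolding complex_product_def by blast

lemma complex_linearD:
  assumes "complex_linear X mult" "A \<subseteq> X" "A \<noteq> {}" "B \<subseteq> X" "B \<noteq> {}"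
  shows "complex_product mult A B = A \<or> complex_product mult A B = B"
  using assms unfolding complex_linear_def by blast

lemma complex_linear_opposite:
  assumes "complex_linear X mult"
  shows "complex_linear X (\<lambda>x y. mult y x)"
proof -
  have "complex_product (\<lambda>x y. mult y x) A B = complex_product mult B A" for A B
    unfolding complex_product_def by blast
  then show ?thesis using assms unfolding complex_linear_def by (metis insert_commute)
qed

lemma generated_singleton: "generated X {A} = {C. A \<subseteq> C \<and> C \<subseteq> X}"
  unfolding generated_def by auto

lemma generated_singleton_inject:
  assumes "A \<subseteq> X" "B \<subseteq> X" "generated X {A} = generated X {B}"
  shows "A = B"
proof -
  have "A \<in> generated X {B}" "B \<in> generated X {A}"
    using assms unfolding generated_singleton by blast+
  then show ?thesis unfolding generated_singleton by blast
qed

lemma principal_filter: "A \<subseteq> X \<Longrightarrow> A \<noteq> {} \<Longrightarrow> generated X {A} \<in> filters X"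
  unfolding generated_singleton filters_def upfamily_def by blast

lemma principal_mult_principal:
  assumes A: "A \<subseteq> X" "A \<noteq> {}" and B: "B \<subseteq> X" "B \<noteq> {}"
  shows "upfamily_mult X mult (generated X {A}) (generated X {B}) =
         generated X {complex_product mult A B}"
proof (rule set_eqI)
  fix C
  have uA: "upfamily X (generated X {A})" and uB: "upfamily X (generated X {B})"
    using principal_filter[OF A] principal_filter[OF B] unfolding filters_def by auto
  show "C \<in> upfamily_mult X mult (generated X {A}) (generated X {B}) \<longleftrightarrow>
      C \<in> generated X {complex_product mult A B}"
    unfolding mem_upfamily_mult[OF uA uB] unfolding generated_singleton
    using A(1) B(1) by (auto simp: complex_product_subset_iff)
qed

lemma complex_linear_if_linear_filters:
  assumes sg: "semigroup_on X mult"
    and lin: "linear_semigroup (filters X) (upfamily_mult X mult)"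
  shows "complex_linear X mult"
  unfolding complex_linear_def
proof (intro allI impI, elim conjE)
  fix A B assume A: "A \<subseteq> X" "A \<noteq> {}" and B: "B \<subseteq> X" "B \<noteq> {}"
  have AB: "complex_product mult A B \<subseteq> X"
    using A B semigroup_on.closed[OF sg] unfolding complex_product_def by blast
  have "generated X {complex_product mult A B} \<in> {generated X {A}, generated X {B}}"
    using lin principal_filter[OF A] principal_filter[OF B]
    unfolding linear_semigroup_def principal_mult_principal[OF A B, symmetric] by blast
  then show "complex_product mult A B \<in> {A, B}"
    using generated_singleton_inject[OF AB] A(1) B(1) by blast
qed

section \<open>Semigroups with linear complex products\<close>

lemma complex_linear_imp_linear:
  assumes "complex_linear X mult" "x \<in> X" "y \<in> X"
  shows "mult x y = x \<or> mult x y = y"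
  using complex_linearD[OF assms(1), of "{x}" "{y}"] assms(2,3)
  unfolding complex_product_def by auto

text \<open>
  The set \<open>{a}{b, c} = {a, ac}\<close> contains \<open>a\<close>, so for \<open>c \<noteq> a\<close> it can only be the factor \<open>{a}\<close>. Likewise
  \<open>{c, b}{a} = {ca, b}\<close> contains \<open>b \<noteq> a\<close>, so it is the factor \<open>{c, b}\<close>.
\<close>

lemma left_zero_pair_spreads:
  assumes cl: "complex_linear X mult" and X: "a \<in> X" "b \<in> X" "c \<in> X"
    and ab: "a \<noteq> b" "mult a b = a" "mult b a = b" and ca: "c \<noteq> a"
  shows "mult a c = a \<and> mult c a = c"
proof (cases "c = b")
  case True
  then show ?thesis using ab by simp
next
  case False
  have "complex_product mult {a} {b, c} = {a, mult a c}"
    using ab unfolding complex_product_def by auto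
  then have "{a, mult a c} = {a} \<or> {a, mult a c} = {b, c}"
    using complex_linearD[OF cl, of "{a}" "{b, c}"] X by simp
  then have "mult a c = a" using ab(1) ca by blast
  moreover have "complex_product mult {c, b} {a} = {mult c a, b}"
    using ab unfolding complex_product_def by auto
  then have "{mult c a, b} = {a} \<or> {mult c a, b} = {c, b}"
    using complex_linearD[OF cl, of "{c, b}" "{a}"] X by auto
  then have "mult c a = c" using ab(1) False by blast
  ultimately show ?thesis ..
qed

text \<open>
  Spreading twice joins any two elements \<open>x\<close> and \<open>y\<close>: from the pair \<open>a, b\<close> to \<open>a, x\<close>, and from
  \<open>x, a\<close> to \<open>x, y\<close>.
\<close>

lemma left_zeros_if_left_zero_pair:
  assumes cl: "complex_linear X mult" and X: "a \<in> X" "b \<in> X"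
    and ab: "a \<noteq> b" "mult a b = a" "mult b a = b" and x: "x \<in> X" and y: "y \<in> X"
  shows "mult x y = x"
proof -
  consider "x = y" | "x = a" "y \<noteq> x" | "x \<noteq> a" "y \<noteq> x" by blast
  then show ?thesis
  proof cases
    case 1
    then show ?thesis using complex_linear_imp_linear[OF cl x y] by blast
  next
    case 2
    then show ?thesis using left_zero_pair_spreads[OF cl X y ab] by blast
  next
    case 3
    then have "mult a x = a" "mult x a = x"
      using left_zero_pair_spreads[OF cl X x ab] by blast+
    then show ?thesis
      using left_zero_pair_spreads[OF cl x X(1) y] 3 by blast
  qed
qed

lemma no_three_chain:
  assumes cl: "complex_linear X mult" and X: "a \<in> X" "b \<in> X" "c \<in> X"
    and ab: "mult a b = a" and cb: "mult c b = b" and ne: "a \<noteq> b" "b \<noteq> c"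
  shows False
proof -
  have "complex_product mult {a, c} {b} = {a, b}"
    using ab cb unfolding complex_product_def by auto
  then have "{a, b} = {a, c} \<or> {a, b} = {b}"
    using complex_linearD[OF cl, of "{a, c}" "{b}"] X by simp
  then show False using ne by (auto simp: doubleton_eq_iff)
qed

lemma card_le_2_if_commutative:
  assumes cl: "complex_linear X mult"
    and comm: "\<And>x y. x \<in> X \<Longrightarrow> y \<in> X \<Longrightarrow> mult x y = mult y x"
  shows "finite X \<and> card X \<le> 2"
proof (rule ccontr)
  assume "\<not> (finite X \<and> card X \<le> 2)"
  then have "infinite X \<or> 3 \<le> card X" by linarith
  then obtain T where T: "T \<subseteq> X" "card T = 3"
    by (metis infinite_arbitrarily_large obtain_subset_with_card_n)
  then obtain a b c where abc: "T = {a, b, c}" "a \<noteq> b" "b \<noteq> c" "a \<noteq> c"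
    by (auto simp: card_3_iff)
  then have X: "a \<in> X" "b \<in> X" "c \<in> X" using T by auto
  (* Each choice of the three products orders {a, b, c} as a chain or as a cycle; either way some
     element has one of the others below it and the remaining one above it. *)
  have "mult a b = a \<or> mult a b = b" "mult b c = b \<or> mult b c = c" "mult a c = a \<or> mult a c = c"
    using complex_linear_imp_linear[OF cl] X by blast+
  moreover have "mult b a = mult a b" "mult c b = mult b c" "mult c a = mult a c"
    using comm X by blast+
  ultimately show False
    using no_three_chain[OF cl] X abc(2-4) by metis
qed

lemma classification_if_complex_linear:
  assumes sg: "semigroup_on X mult" and cl: "complex_linear X mult"
  shows "left_zeros X mult \<or> right_zeros X mult \<or>
         (semilattice_on X mult \<and> finite X \<and> card X \<le> 2)"
proof (cases "\<forall>x\<in>X. \<forall>y\<in>X. mult x y = mult y x")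
  case True
  moreover have "\<forall>x\<in>X. mult x x = x" using complex_linear_imp_linear[OF cl] by blast
  ultimately have "semilattice_on X mult" using sg unfolding semilattice_on_def by blast
  then show ?thesis using card_le_2_if_commutative[OF cl] True by blast
next
  case False
  then obtain a b where X: "a \<in> X" "b \<in> X" and nc: "mult a b \<noteq> mult b a" by blast
  then have ne: "a \<noteq> b" by blast
  from X nc consider "mult a b = a" "mult b a = b" | "mult a b = b" "mult b a = a"
    using complex_linear_imp_linear[OF cl] by metis
  then show ?thesis
  proof cases
    case 1
    then have "left_zeros X mult"
      using left_zeros_if_left_zero_pair[OF cl X ne] sg unfolding left_zeros_def by blast
    then show ?thesis ..
  next
    case 2
    then have "right_zeros X mult"
      using left_zeros_if_left_zero_pair[OF complex_linear_opposite[OF cl] X ne] sg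
      unfolding right_zeros_def by blast
    then show ?thesis by blast
  qed
qed

section \<open>Linearity of the linked upfamilies\<close>

lemma upfamily_mult_left_zeros:
  assumes lz: "left_zeros X mult" and U: "upfamily X \<U>" and V: "upfamily X \<V>"
  shows "upfamily_mult X mult \<U> \<V> = \<U>"
proof (rule set_eqI)
  fix A
  have "{x\<in>X. {y\<in>X. mult x y \<in> A} \<in> \<V>} = A" if "A \<subseteq> X"
  proof -
    have "{y\<in>X. mult x y \<in> A} = (if x \<in> A then X else {})" if "x \<in> X" for x
      using lz that unfolding left_zeros_def by auto
    moreover have "{} \<notin> \<V>" using V unfolding upfamily_def by blast
    ultimately show ?thesis
      using \<open>A \<subseteq> X\<close> upfamily_carrier_mem[OF V] by (auto cong: conj_cong split: if_splits)
  qed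
  moreover have "A \<in> \<U> \<Longrightarrow> A \<subseteq> X" using U unfolding upfamily_def by blast
  ultimately show "A \<in> upfamily_mult X mult \<U> \<V> \<longleftrightarrow> A \<in> \<U>"
    unfolding mem_upfamily_mult[OF U V] by auto
qed

lemma upfamily_mult_right_zeros:
  assumes rz: "right_zeros X mult" and U: "upfamily X \<U>" and V: "upfamily X \<V>"
  shows "upfamily_mult X mult \<U> \<V> = \<V>"
proof (rule set_eqI)
  fix A
  have "{x\<in>X. {y\<in>X. mult x y \<in> A} \<in> \<V>} = (if A \<in> \<V> then X else {})" if "A \<subseteq> X"
  proof -
    have "{y\<in>X. mult x y \<in> A} = A" if "x \<in> X" for x
      using rz that \<open>A \<subseteq> X\<close> unfolding right_zeros_def by auto
    then show ?thesis by auto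
  qed
  moreover have "{} \<notin> \<U>" using U unfolding upfamily_def by blast
  moreover have "A \<in> \<V> \<Longrightarrow> A \<subseteq> X" using V unfolding upfamily_def by blast
  ultimately show "A \<in> upfamily_mult X mult \<U> \<V> \<longleftrightarrow> A \<in> \<V>"
    using upfamily_carrier_mem[OF U] unfolding mem_upfamily_mult[OF U V] by (auto split: if_splits)
qed

lemma subset_of_card_le_2:
  assumes "finite X" "card X \<le> 2" "a \<in> C" "C \<subseteq> X"
  shows "C = {a} \<or> C = X"
proof (rule ccontr)
  assume "\<not> ?thesis"
  then obtain b c where "b \<in> C" "b \<noteq> a" "c \<in> X" "c \<notin> C" using assms(3,4) by blast
  moreover from this have "c \<noteq> a" "c \<noteq> b" using assms(3) by blast+
  ultimately have "card {a, b, c} = 3" "{a, b, c} \<subseteq> X" using assms(3,4) by auto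
  then show False using card_mono[OF assms(1), of "{a, b, c}"] assms(2) by simp
qed

lemma linked_principal_of_card_le_2:
  assumes fin: "finite X" "card X \<le> 2" and L: "\<L> \<in> linked_upfamilies X"
  shows "\<exists>A. A \<subseteq> X \<and> A \<noteq> {} \<and> \<L> = generated X {A}"
proof -
  have up: "upfamily X \<L>" and link: "\<And>A B. A \<in> \<L> \<Longrightarrow> B \<in> \<L> \<Longrightarrow> A \<inter> B \<noteq> {}"
    using L unfolding linked_upfamilies_def by auto
  show ?thesis
  proof (cases "\<exists>a. {a} \<in> \<L>")
    case True
    then obtain a where a: "{a} \<in> \<L>" by blast
    then have aX: "a \<in> X" using up unfolding upfamily_def by blast
    have "\<L> = generated X {{a}}"
    proof
      show "\<L> \<subseteq> generated X {{a}}"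
        using link[OF a] up unfolding generated_singleton upfamily_def by blast
      show "generated X {{a}} \<subseteq> \<L>"
        using upfamily_up[OF up a] unfolding generated_singleton by blast
    qed
    then show ?thesis using aX by blast
  next
    case False
    have "A = X" if A: "A \<in> \<L>" for A
    proof -
      obtain a where "a \<in> A" "A \<subseteq> X" using up A unfolding upfamily_def by blast
      then show ?thesis using subset_of_card_le_2[OF fin] False A by blast
    qed
    then have "\<L> = {X}" using upfamily_carrier_mem[OF up] by blast
    then have "\<L> = generated X {X}" unfolding generated_singleton by blast
    moreover have "X \<noteq> {}" using up upfamily_carrier_mem[OF up] unfolding upfamily_def by blast
    ultimately show ?thesis by blast
  qed
qed

text \<open>
  Because of idempotency, the complex product of \<open>{a}\<close> and \<open>X\<close>, in either order, is a subset of \<open>X\<close>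
  containing \<open>a\<close>; with at most two elements available it is \<open>{a}\<close> or \<open>X\<close>.
\<close>

lemma complex_linear_of_card_le_2:
  assumes sl: "semilattice_on X mult" and fin: "finite X" "card X \<le> 2"
  shows "complex_linear X mult"
  unfolding complex_linear_def
proof (intro allI impI, elim conjE)
  fix A B assume A: "A \<subseteq> X" "A \<noteq> {}" and B: "B \<subseteq> X" "B \<noteq> {}"
  have closed: "mult x y \<in> X" if "x \<in> X" "y \<in> X" for x y
    using sl that semigroup_on.closed unfolding semilattice_on_def by metis
  have idem: "mult x x = x" if "x \<in> X" for x
    using sl that unfolding semilattice_on_def by blast
  have sub: "complex_product mult A B \<subseteq> X"
    using A B closed unfolding complex_product_def by blast
  note dichotomy = subset_of_card_le_2[OF fin]
  obtain a b where a: "a \<in> A" "a \<in> X" and b: "b \<in> B" "b \<in> X" using A B by blast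
  have "A = {a} \<or> A = X" "B = {b} \<or> B = X"
    using dichotomy a b A B by blast+
  then consider "A = {a}" "B = {b}" | "A = {a}" "B = X" | "A = X" "B = {b}" | "A = X" "B = X"
    by blast
  then show "complex_product mult A B \<in> {A, B}"
  proof cases
    case 1
    have "{a, mult a b} = {a} \<or> {a, mult a b} = X"
      by (rule dichotomy) (use closed a b in auto)
    then have "mult a b = a \<or> mult a b = b" using b(2) idem[OF b(2)] by auto
    then show ?thesis using 1 unfolding complex_product_def by auto
  next
    case 2
    have "a \<in> complex_product mult A B"
      using 2 complex_productI[of a A a B mult] idem[OF a(2)] a by simp
    then show ?thesis using dichotomy[OF _ sub] 2 by blast
  next
    case 3
    have "b \<in> complex_product mult A B"
      using 3 complex_productI[of b A b B mult] idem[OF b(2)] b by simp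
    then show ?thesis using dichotomy[OF _ sub] 3 by blast
  next
    case 4
    have "x \<in> complex_product mult A B" if "x \<in> X" for x
      using 4 complex_productI[of x A x B mult] idem that by simp
    then have "complex_product mult A B = X" using sub by blast
    then show ?thesis using 4 by simp
  qed
qed

lemma linear_linked_upfamilies_if_classified:
  assumes sg: "semigroup_on X mult"
    and cls: "left_zeros X mult \<or> right_zeros X mult \<or>
              (semilattice_on X mult \<and> finite X \<and> card X \<le> 2)"
  shows "linear_semigroup (linked_upfamilies X) (upfamily_mult X mult)"
proof -
  have "upfamily_mult X mult \<U> \<V> \<in> {\<U>, \<V>}"
    if U: "\<U> \<in> linked_upfamilies X" and V: "\<V> \<in> linked_upfamilies X" for \<U> \<V>
  proof -
    have up: "upfamily X \<U>" "upfamily X \<V>" using U V unfolding linked_upfamilies_def by auto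
    from cls consider "left_zeros X mult" | "right_zeros X mult"
      | "semilattice_on X mult" "finite X" "card X \<le> 2" by blast
    then show ?thesis
    proof cases
      case 1
      then show ?thesis using upfamily_mult_left_zeros[OF _ up] by blast
    next
      case 2
      then show ?thesis using upfamily_mult_right_zeros[OF _ up] by blast
    next
      case 3
      then obtain A B where A: "A \<subseteq> X" "A \<noteq> {}" and B: "B \<subseteq> X" "B \<noteq> {}"
        and eq: "\<U> = generated X {A}" "\<V> = generated X {B}"
        using linked_principal_of_card_le_2 U V by metis
      have "complex_product mult A B = A \<or> complex_product mult A B = B"
        using complex_linearD[OF complex_linear_of_card_le_2[OF 3] A B] .
      then show ?thesis
        unfolding eq principal_mult_principal[OF A B] by auto
    qed
  qed
  then show ?thesis
    using semigroup_on_linked_upfamilies[OF sg] unfolding linear_semigroup_def by blast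
qed

lemma linear_filters_if_linear_linked_upfamilies:
  assumes sg: "semigroup_on X mult"
    and lin: "linear_semigroup (linked_upfamilies X) (upfamily_mult X mult)"
  shows "linear_semigroup (filters X) (upfamily_mult X mult)"
  using lin semigroup_on_filters[OF sg] filters_subset_linked[of X]
  unfolding linear_semigroup_def by blast

section \<open>The characterization\<close>

theorem theorem4p2:
  fixes X :: "'a set" and mult :: "'a \<Rightarrow> 'a \<Rightarrow> 'a"
  assumes "semigroup_on X mult"
  shows "(linear_semigroup (filters X) (upfamily_mult X mult) \<longleftrightarrow>
            linear_semigroup (linked_upfamilies X) (upfamily_mult X mult)) \<and>
         (linear_semigroup (linked_upfamilies X) (upfamily_mult X mult) \<longleftrightarrow>
            left_zeros X mult \<or> right_zeros X mult \<or>
            (semilattice_on X mult \<and> finite X \<and> card X \<le> 2))"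
  using linear_filters_if_linear_linked_upfamilies[OF assms]
    linear_linked_upfamilies_if_classified[OF assms]
    classification_if_complex_linear[OF assms complex_linear_if_linear_filters[OF assms]]
  by blast

end
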